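(* Let $R$ be a $*$-ring and let $a,b,c\in R$. Then the following are equivalent: (1) $a\in R_{lh(b,c)}^{\mathrm{cEP}}$, i.e. $a$ has a left hybrid core-EP-$(b,c)$-inverse. (2) $a$ has a core-EP inverse $a^{\mathrm{cEP}}$ and $aa^{\mathrm{cEP}}a\in R_{lh(b,c)}^{\mathrm{core}}$. In this case, $a^{\mathrm{cEP}}=(aa^{\mathrm{cEP}}a)_{lh}^{(b,c)}$.
   Context: A $*$-ring is an associative ring with identity with an involution $x\mapsto x^*$ satisfying $(x+y)^*=x^*+y^*$, $(xy)^*=y^*x^*$, $(x^* )^*=x$. For $x\in R$, $\ell(x)=\{r\in R: rx=0\}$. Core inverse: $a\in R$ is core invertible ($a\in R^{\mathrm{core}}$) if there is $x\in R$ with $ax^2=x$, $(ax)^*=ax$, $xa^2=a$; such $x$ is unique and denoted $a^{\mathrm{core}}$. Core-EP inverse: $a\in R^{\mathrm{cEP}}$ if there are $x\in R$ and a positive integer $k$ with $ax^2=x$, $(ax)^*=ax$, $xa^{k+1}=a^k$; such $x$ is unique and denoted $a^{\mathrm{cEP}}$. Left hybrid $(b,c)$-inverse: $a\in R_{lh}^{(b,c)}$ if there is $x\in R$ with $xax=x$, $\ell(x)=\ell(b)$, $Rx=Rc$; such $x$ is unique and denoted $a_{lh}^{(b,c)}$. Left hybrid core-$(b,c)$-inverse: $a\in R_{lh(b,c)}^{\mathrm{core}}$ if $a\in R^{\mathrm{core}}$, $a\in R_{lh}^{(b,c)}$ and $a^{\mathrm{core}}=a_{lh}^{(b,c)}$.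 Left hybrid core-EP-$(b,c)$-inverse: $a\in R_{lh(b,c)}^{\mathrm{cEP}}$ if there exist $x,y\in R$ with $a=x+y$, $x^*y=yx=0$, $x\in R_{lh(b,c)}^{\mathrm{core}}$ and $y$ nilpotent. *)

theory Defs
  imports Main
begin

(* The class ring_1 is avoided because it contains the axiom 0 \<noteq> 1, whereas an
   associative ring with identity may be the zero ring. *)
class star_ring = ring + monoid_mult +
  fixes star :: "'a \<Rightarrow> 'a"  ("_\<^sup>\<star>" [1000] 999)
  assumes star_add: "(x + y)\<^sup>\<star> = x\<^sup>\<star> + y\<^sup>\<star>"
    and star_mult: "(x * y)\<^sup>\<star> = y\<^sup>\<star> * x\<^sup>\<star>"
    and star_star: "(x\<^sup>\<star>)\<^sup>\<star> = x"

definition left_annihilator :: "'a::star_ring \<Rightarrow> 'a set" where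
  "left_annihilator x = {r. r * x = 0}"

definition left_principal_ideal :: "'a::star_ring \<Rightarrow> 'a set" where
  "left_principal_ideal x = {r * x | r. True}"

definition nilpotent :: "'a::star_ring \<Rightarrow> bool" where
  "nilpotent y \<longleftrightarrow> (\<exists>n>0. y ^ n = 0)"

definition is_core_inverse :: "'a::star_ring \<Rightarrow> 'a \<Rightarrow> bool" where
  "is_core_inverse a x \<longleftrightarrow> a * x ^ 2 = x \<and> (a * x)\<^sup>\<star> = a * x \<and> x * a ^ 2 = a"

definition is_cEP_inverse :: "'a::star_ring \<Rightarrow> 'a \<Rightarrow> bool" where
  "is_cEP_inverse a x \<longleftrightarrow>
     (\<exists>k>0. a * x ^ 2 = x \<and> (a * x)\<^sup>\<star> = a * x \<and> x * a ^ (k + 1) = a ^ k)"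

definition is_lh_inverse :: "'a::star_ring \<Rightarrow> 'a \<Rightarrow> 'a \<Rightarrow> 'a \<Rightarrow> bool" where
  "is_lh_inverse b c a x \<longleftrightarrow> x * a * x = x
     \<and> left_annihilator x = left_annihilator b
     \<and> left_principal_ideal x = left_principal_ideal c"

definition core_invertible :: "'a::star_ring set" where
  "core_invertible = {a. \<exists>x. is_core_inverse a x}"

definition cEP_invertible :: "'a::star_ring set" where
  "cEP_invertible = {a. \<exists>x. is_cEP_inverse a x}"

definition lh_invertible :: "'a::star_ring \<Rightarrow> 'a \<Rightarrow> 'a set" where
  "lh_invertible b c = {a. \<exists>x. is_lh_inverse b c a x}"

lemma cEP_inverse_power_mono:
  fixes a x :: "'a::star_ring"
  assumes "x * a ^ (k + 1) = a ^ k" and "k \<le> m"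
  shows "x * a ^ (m + 1) = a ^ m"
proof -
  have "a ^ (k + 1) * a ^ (m - k) = a ^ (m + 1)"
    using assms(2) by (subst power_add[symmetric]) simp
  then have "x * a ^ (m + 1) = x * a ^ (k + 1) * a ^ (m - k)"
    by (simp only: mult.assoc)
  also have "\<dots> = a ^ k * a ^ (m - k)"
    by (simp only: assms(1))
  also have "\<dots> = a ^ m"
    using assms(2) by (subst power_add[symmetric]) simp
  finally show ?thesis .
qed

lemma cEP_inverse_eq_power:
  fixes a x :: "'a::star_ring"
  assumes "a * x ^ 2 = x"
  shows "a ^ m * x ^ (m + 1) = x"
proof (induction m)
  case (Suc m)
  have "a ^ Suc m * x ^ (Suc m + 1) = a ^ m * (a * x ^ 2) * x ^ m"
    by (simp only: power_Suc2[of a] power_Suc[of x] power2_eq_square mult.assoc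
        Suc_eq_plus1[symmetric])
  also have "\<dots> = x"
    using Suc by (simp add: assms mult.assoc)
  finally show ?case .
qed simp

lemma is_cEP_inverse_unique:
  fixes a x y :: "'a::star_ring"
  assumes "is_cEP_inverse a x" and "is_cEP_inverse a y"
  shows "x = y"
proof -
  obtain k l where x: "a * x ^ 2 = x" "(a * x)\<^sup>\<star> = a * x" "x * a ^ (k + 1) = a ^ k"
    and y: "a * y ^ 2 = y" "(a * y)\<^sup>\<star> = a * y" "y * a ^ (l + 1) = a ^ l"
    using assms unfolding is_cEP_inverse_def by blast
  define m where "m = max k l"
  have absorb: "u * (a * v) = v"
    if "u * a ^ (m + 1) = a ^ m" "a ^ m * v ^ (m + 1) = v" for u v
  proof -
    have "u * (a * v) = u * (a * (a ^ m * v ^ (m + 1)))"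
      using that(2) by simp
    also have "\<dots> = u * a ^ (m + 1) * v ^ (m + 1)"
      by (simp add: mult.assoc)
    also have "\<dots> = v"
      using that by simp
    finally show ?thesis .
  qed
  have xm: "x * a ^ (m + 1) = a ^ m" and ym: "y * a ^ (m + 1) = a ^ m"
    using cEP_inverse_power_mono[OF x(3), of m] cEP_inverse_power_mono[OF y(3), of m]
    by (simp_all add: m_def)
  note xe = cEP_inverse_eq_power[OF x(1), of m]
  note ye = cEP_inverse_eq_power[OF y(1), of m]
  have "a * x = (a * y * (a * x))\<^sup>\<star>"
    using absorb[OF ym xe] x(2) by (simp add: mult.assoc)
  also have "\<dots> = a * x * (a * y)"
    using x(2) y(2) star_mult by metis
  also have "\<dots> = a * y"
    using absorb[OF xm ye] by (simp add: mult.assoc)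
  finally show "x = y"
    using absorb[OF xm xe] absorb[OF xm ye] by metis
qed

lemma is_core_inverse_imp_is_cEP_inverse:
  "is_core_inverse a x \<Longrightarrow> is_cEP_inverse a x"
  unfolding is_core_inverse_def is_cEP_inverse_def
  by (intro exI[of _ 1]) (auto simp: power2_eq_square)

lemma is_core_inverse_unique:
  "is_core_inverse a x \<Longrightarrow> is_core_inverse a y \<Longrightarrow> x = y"
  using is_core_inverse_imp_is_cEP_inverse is_cEP_inverse_unique by blast

lemma is_lh_inverse_unique:
  fixes a b c x y :: "'a::star_ring"
  assumes "is_lh_inverse b c a x" and "is_lh_inverse b c a y"
  shows "x = y"
proof -
  have x: "x * a * x = x" and y: "y * a * y = y"
    and ann: "left_annihilator x = left_annihilator y"
    and ideal: "left_principal_ideal x = left_principal_ideal y"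
    using assms unfolding is_lh_inverse_def by auto
  have "1 - x * a \<in> left_annihilator x"
    using x by (simp add: left_annihilator_def left_diff_distrib)
  then have "x * a * y = y"
    unfolding ann by (simp add: left_annihilator_def left_diff_distrib)
  moreover have "x \<in> left_principal_ideal x"
    by (auto simp: left_principal_ideal_def intro: exI[of _ 1])
  then have "x \<in> left_principal_ideal y"
    by (simp only: ideal)
  then obtain s where "x = s * y"
    unfolding left_principal_ideal_def by blast
  then have "x * a * y = x"
    using y by (simp add: mult.assoc)
  ultimately show ?thesis
    by simp
qed

(* By the uniqueness lemmas above, the descriptions below denote the respective inverse
   whenever the element is invertible in the respective sense; otherwise they carry no
   information. *)
definition core_inverse :: "'a::star_ring \<Rightarrow> 'a" where
  "core_inverse a = (THE x. is_core_inverse a x)"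

definition cEP_inverse :: "'a::star_ring \<Rightarrow> 'a" where
  "cEP_inverse a = (THE x. is_cEP_inverse a x)"

definition lh_inverse :: "'a::star_ring \<Rightarrow> 'a \<Rightarrow> 'a \<Rightarrow> 'a" where
  "lh_inverse b c a = (THE x. is_lh_inverse b c a x)"

lemma core_inverse_eq: "is_core_inverse a x \<Longrightarrow> core_inverse a = x"
  unfolding core_inverse_def by (blast intro: is_core_inverse_unique)

lemma cEP_inverse_eq: "is_cEP_inverse a x \<Longrightarrow> cEP_inverse a = x"
  unfolding cEP_inverse_def by (blast intro: is_cEP_inverse_unique)

lemma lh_inverse_eq: "is_lh_inverse b c a x \<Longrightarrow> lh_inverse b c a = x"
  unfolding lh_inverse_def by (blast intro: is_lh_inverse_unique)

definition lh_core_invertible :: "'a::star_ring \<Rightarrow> 'a \<Rightarrow> 'a set" where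
  "lh_core_invertible b c =
     {a. a \<in> core_invertible \<and> a \<in> lh_invertible b c \<and> core_inverse a = lh_inverse b c a}"

definition lh_cEP_invertible :: "'a::star_ring \<Rightarrow> 'a \<Rightarrow> 'a set" where
  "lh_cEP_invertible b c =
     {a. \<exists>x y. a = x + y \<and> x\<^sup>\<star> * y = 0 \<and> y * x = 0
           \<and> x \<in> lh_core_invertible b c \<and> nilpotent y}"

end

(* In a decomposition a = x + y with x core invertible, x^* y = y x = 0 and y nilpotent, the
   core inverse z of x is the core-EP inverse of a, and a z a = x, so the decomposition is
   determined by a. Conversely, if z is the core-EP inverse of a, then a z is a projection
   whose range a preserves, and a = a z a + (1 - a z) a is such a decomposition. *)
theory Submission
  imports Defs
begin

text \<open>Since \<open>z = a ^ m * z ^ (m + 1)\<close> for every \<open>m\<close>, both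
  \<open>z\<close> and \<open>a * z\<close> lie in \<open>a ^ k * R\<close> for the index
  \<open>k\<close>, and there left multiplication by \<open>z * a\<close> is the identity.\<close>

lemma is_cEP_inverse_absorb:
  fixes a z :: "'a::star_ring"
  assumes "is_cEP_inverse a z"
  shows "z * a * z = z" and "z * a * (a * z) = a * z"
proof -
  obtain k where z: "a * z ^ 2 = z" and k: "z * a ^ (k + 1) = a ^ k"
    using assms unfolding is_cEP_inverse_def by blast
  have e: "a ^ m * z ^ (m + 1) = z" for m
    using cEP_inverse_eq_power[OF z] .
  have "z * a * z = z * a * (a ^ k * z ^ (k + 1))"
    by (simp only: e)
  also have "\<dots> = z * a ^ (k + 1) * z ^ (k + 1)"
    by (simp add: mult.assoc)
  finally show "z * a * z = z"
    by (simp only: k e)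
  \<comment> \<open>The extra factor \<open>a\<close> in
    \<open>a * z = a * (a ^ k * z ^ (k + 1))\<close> calls for the next exponent.\<close>
  have k': "z * a ^ (Suc k + 1) = a ^ Suc k"
    by (rule cEP_inverse_power_mono[OF k]) simp
  have "z * a * (a * z) = z * a * (a * (a ^ k * z ^ (k + 1)))"
    by (simp only: e)
  also have "\<dots> = z * a ^ (Suc k + 1) * z ^ (k + 1)"
    by (simp add: mult.assoc)
  also have "\<dots> = a * (a ^ k * z ^ (k + 1))"
    by (simp only: k' power_Suc mult.assoc)
  finally show "z * a * (a * z) = a * z"
    by (simp only: e)
qed

text \<open>In the expanded power, \<open>y * x = 0\<close> kills every word with a \<open>y\<close>
  directly before an \<open>x\<close>; each surviving word except \<open>y ^ m\<close> begins with
  \<open>x\<close>.\<close>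

lemma power_add_eq_left_multiple:
  fixes x y :: "'a::star_ring"
  assumes "y * x = 0"
  shows "\<exists>w. (x + y) ^ m = x * w + y ^ m"
proof (induction m)
  case 0
  show ?case
    by (rule exI[of _ 0]) simp
next
  case (Suc m)
  then obtain w where "(x + y) ^ m = x * w + y ^ m"
    by blast
  then have "(x + y) ^ Suc m = x * (x * w + y ^ m) + y * x * w + y ^ Suc m"
    by (simp add: distrib_left distrib_right mult.assoc add.assoc)
  then show ?case
    using assms by auto
qed

text \<open>The orthogonality relations give \<open>y * z = z * y = 0\<close>, so \<open>z\<close>
  does not see \<open>y\<close>. Nilpotency puts a power of \<open>x + y\<close> into
  \<open>x * R\<close>, which \<open>z * x\<close> fixes from the left.\<close>

lemma core_nilpotent_decomposition_imp:
  fixes x y z :: "'a::star_ring"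
  assumes core: "is_core_inverse x z"
    and orth: "x\<^sup>\<star> * y = 0" "y * x = 0"
    and nil: "nilpotent y"
  shows "is_cEP_inverse (x + y) z" and "(x + y) * z * (x + y) = x"
proof -
  have z: "x * z ^ 2 = z" "(x * z)\<^sup>\<star> = x * z" "z * x ^ 2 = x"
    using core unfolding is_core_inverse_def by auto
  have zxz: "z * (x * z) = z"
    using is_cEP_inverse_absorb(1)[OF is_core_inverse_imp_is_cEP_inverse[OF core]]
    by (simp add: mult.assoc)
  have "y * z = y * x * z ^ 2"
    by (simp add: z(1) mult.assoc)
  then have az: "(x + y) * z = x * z"
    using orth(2) by (simp add: distrib_right)
  \<comment> \<open>Writing \<open>z\<close> as \<open>z * (x * z)\<close> and using that
    \<open>x * z\<close> is self-adjoint brings \<open>x\<^sup>\<star>\<close> next to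
    \<open>y\<close>.\<close>
  have "z * y = z * (x * z)\<^sup>\<star> * y"
    by (simp only: z(2) zxz)
  also have "\<dots> = z * z\<^sup>\<star> * (x\<^sup>\<star> * y)"
    by (simp only: star_mult mult.assoc)
  finally have za: "z * (x + y) = z * x"
    using orth(1) by (simp add: distrib_left)
  obtain n where n: "n > 0" "y ^ n = 0"
    using nil unfolding nilpotent_def by blast
  obtain w where w: "(x + y) ^ n = x * w"
    using power_add_eq_left_multiple[OF orth(2), of n] n(2) by auto
  have "z * (x + y) ^ (n + 1) = z * (x + y) * (x + y) ^ n"
    by (simp add: mult.assoc)
  also have "\<dots> = z * x ^ 2 * w"
    by (simp only: za w power2_eq_square mult.assoc)
  finally have "z * (x + y) ^ (n + 1) = (x + y) ^ n"
    by (simp only: z(3) w)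
  moreover have "(x + y) * z ^ 2 = z"
    using az z(1) by (simp add: power2_eq_square mult.assoc[symmetric])
  ultimately show "is_cEP_inverse (x + y) z"
    unfolding is_cEP_inverse_def using n(1) z(2) az by auto
  have "(x + y) * z * (x + y) = x * (z * (x + y))"
    by (simp only: az mult.assoc)
  \<comment> \<open>The last \<open>x\<close> is expanded as \<open>z * x ^ 2\<close> to create the
    factor \<open>x * z ^ 2 = z\<close>.\<close>
  also have "\<dots> = x * z * (z * x ^ 2)"
    by (simp only: za z(3) mult.assoc)
  also have "\<dots> = x * z ^ 2 * x ^ 2"
    by (simp only: power2_eq_square mult.assoc)
  finally show "(x + y) * z * (x + y) = x"
    by (simp only: z)
qed

text \<open>The element \<open>p = a * z\<close> is a self-adjoint idempotent with
  \<open>p * a * p = a * p\<close>, and the second summand is \<open>(1 - p) * a\<close>.\<close>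

lemma cEP_inverse_decomposition:
  fixes a z :: "'a::star_ring"
  assumes cEP: "is_cEP_inverse a z"
  shows "(a * z * a)\<^sup>\<star> * (a - a * z * a) = 0"
    and "(a - a * z * a) * (a * z * a) = 0"
    and "nilpotent (a - a * z * a)"
proof -
  obtain k where z: "a * z ^ 2 = z" "(a * z)\<^sup>\<star> = a * z"
    and k: "k > 0" "z * a ^ (k + 1) = a ^ k"
    using cEP unfolding is_cEP_inverse_def by blast
  define p where "p = a * z"
  define y where "y = a - p * a"
  have pp: "p * p = p"
    using is_cEP_inverse_absorb(1)[OF cEP] by (simp add: p_def mult.assoc)
  have pap: "p * a * p = a * p"
    using is_cEP_inverse_absorb(2)[OF cEP] by (simp add: p_def mult.assoc)
  have "(p * a)\<^sup>\<star> * y = a\<^sup>\<star> * p * (a - p * a)"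
    using z(2) by (simp add: star_mult p_def y_def)
  also have "\<dots> = a\<^sup>\<star> * (p * a - p * p * a)"
    by (simp only: right_diff_distrib mult.assoc)
  finally show "(a * z * a)\<^sup>\<star> * (a - a * z * a) = 0"
    by (simp add: pp p_def[symmetric] y_def[symmetric])
  have yp: "y * p = 0"
    by (simp add: y_def left_diff_distrib pap)
  then have "y * (p * a) = 0"
    by (simp add: mult.assoc[symmetric])
  then show "(a - a * z * a) * (a * z * a) = 0"
    by (simp only: p_def y_def)
  \<comment> \<open>Because \<open>y * p = 0\<close>, every factor of a power of \<open>y\<close>
    except the leftmost may be replaced by \<open>a\<close>.\<close>
  have ya: "y * y = y * a"
  proof -
    have "y * (a - p * a) = y * a - y * p * a"
      by (simp only: right_diff_distrib mult.assoc)
    then show ?thesis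
      by (simp add: yp y_def[symmetric])
  qed
  \<comment> \<open>Exponent 0 is excluded: there the formula would force
    \<open>p = 0\<close>.\<close>
  have y_power: "y ^ Suc m = a ^ Suc m - p * a ^ Suc m" for m
  proof (induction m)
    case 0
    show ?case
      by (simp add: y_def)
  next
    case (Suc m)
    have "y ^ Suc (Suc m) = y ^ m * (y * y)"
      by (simp only: power_Suc2 mult.assoc)
    also have "\<dots> = y ^ Suc m * a"
      by (simp only: ya power_Suc2 mult.assoc)
    also have "\<dots> = a ^ Suc m * a - p * (a ^ Suc m * a)"
      by (simp only: Suc left_diff_distrib mult.assoc)
    also have "\<dots> = a ^ Suc (Suc m) - p * a ^ Suc (Suc m)"
      by (simp only: power_Suc2[of a "Suc m"])
    finally show ?case .
  qed
  \<comment> \<open>As \<open>a ^ k = z * a ^ (k + 1)\<close> starts with \<open>z\<close> and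
    \<open>p * z = a * z ^ 2 = z\<close>, the projection \<open>p\<close> fixes
    \<open>a ^ k\<close>, so \<open>y ^ k\<close> vanishes.\<close>
  have "p * a ^ k = a * z * (z * a ^ (k + 1))"
    by (simp only: p_def k(2))
  also have "\<dots> = a * z ^ 2 * a ^ (k + 1)"
    by (simp only: power2_eq_square mult.assoc)
  finally have "p * a ^ k = a ^ k"
    by (simp only: z(1) k(2))
  then have "y ^ k = 0"
    using y_power[of "k - 1"] k(1) by simp
  then show "nilpotent (a - a * z * a)"
    using k(1) by (auto simp: nilpotent_def y_def p_def)
qed

text \<open>The core part \<open>x\<close> equals \<open>a * z * a\<close> for its core inverse
  \<open>z\<close>, and membership of \<open>x\<close> in \<open>lh_core_invertible b c\<close>
  identifies \<open>z\<close> with the left hybrid inverse of \<open>x\<close>.\<close>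

lemma lh_cEP_invertible_imp:
  fixes a b c :: "'a::star_ring"
  assumes "a \<in> lh_cEP_invertible b c"
  shows "a \<in> cEP_invertible"
    and "a * cEP_inverse a * a \<in> lh_core_invertible b c"
    and "cEP_inverse a = lh_inverse b c (a * cEP_inverse a * a)"
proof -
  obtain x y where a: "a = x + y" and xy: "x\<^sup>\<star> * y = 0" "y * x = 0" "nilpotent y"
    and x: "x \<in> lh_core_invertible b c"
    using assms unfolding lh_cEP_invertible_def by blast
  obtain z where z: "is_core_inverse x z"
    using x unfolding lh_core_invertible_def core_invertible_def by blast
  note decomp = core_nilpotent_decomposition_imp[OF z xy, folded a]
  show "a \<in> cEP_invertible"
    using decomp(1) unfolding cEP_invertible_def by blast
  have aza: "a * cEP_inverse a * a = x"
    by (simp only: cEP_inverse_eq[OF decomp(1)] decomp(2))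
  show "a * cEP_inverse a * a \<in> lh_core_invertible b c"
    using x by (simp only: aza)
  show "cEP_inverse a = lh_inverse b c (a * cEP_inverse a * a)"
    using x cEP_inverse_eq[OF decomp(1)] core_inverse_eq[OF z]
    unfolding aza lh_core_invertible_def by simp
qed

lemma lh_cEP_invertibleI:
  fixes a b c :: "'a::star_ring"
  assumes "a \<in> cEP_invertible" and core: "a * cEP_inverse a * a \<in> lh_core_invertible b c"
  shows "a \<in> lh_cEP_invertible b c"
proof -
  have "is_cEP_inverse a (cEP_inverse a)"
    using assms(1) cEP_inverse_eq unfolding cEP_invertible_def by blast
  note decomp = cEP_inverse_decomposition[OF this]
  show ?thesis
    unfolding lh_cEP_invertible_def
    using decomp core
    by (intro CollectI exI[of _ "a * cEP_inverse a * a"]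
        exI[of _ "a - a * cEP_inverse a * a"]) simp
qed

theorem theorem4p1:
  fixes a b c :: "'a::star_ring"
  shows "(a \<in> lh_cEP_invertible b c \<longleftrightarrow>
            a \<in> cEP_invertible \<and> a * cEP_inverse a * a \<in> lh_core_invertible b c)
       \<and> (a \<in> lh_cEP_invertible b c \<longrightarrow>
            cEP_inverse a = lh_inverse b c (a * cEP_inverse a * a))"
  using lh_cEP_invertible_imp lh_cEP_invertibleI by blast

end
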